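(* Let $\mu_X,\mu_Y\in\mathbb{R}$, $\sigma_X,\sigma_Y>0$, and let $n\geq1$ be an integer. Put $s=\sigma_X\sigma_Y$. Let $(X,Y)$ be a bivariate normal random vector with mean vector $(\mu_X,\mu_Y)$, variances $(\sigma_X^2,\sigma_Y^2)$ and correlation coefficient $\rho$, let $Z=XY$, and let $S_n=\sum_{i=1}^n Z_i$, where $Z_1,\ldots,Z_n$ are independent copies of $Z$. 1. Suppose $\rho\in(-1,1)$. Then $$S_n=_d \frac{s}{2}(1+\rho)V_1-\frac{s}{2}(1-\rho)V_2,$$ where $V_1\sim\chi_n'^2(\lambda_+)$ and $V_2\sim\chi_n'^2(\lambda_-)$ are independent with $$\lambda_+=\frac{n}{2(1+\rho)}\bigg(\frac{\mu_X}{\sigma_X}+\frac{\mu_Y}{\sigma_Y}\bigg)^2,\quad \lambda_-=\frac{n}{2(1-\rho)}\bigg(\frac{\mu_X}{\sigma_X}-\frac{\mu_Y}{\sigma_Y}\bigg)^2.$$ 2. Suppose $\rho=1$. Then $$S_n=_d sV_1-\frac{ns}{4}\bigg(\frac{\mu_X}{\sigma_X}-\frac{\mu_Y}{\sigma_Y}\bigg)^2,$$ where $V_1\sim\chi_n'^2(\lambda_+)$ with $\lambda_+=n(\mu_X/\sigma_X+\mu_Y/\sigma_Y)^2/4$. Similarly, if $\rho=-1$, then $$S_n=_d\frac{ns}{4}\bigg(\frac{\mu_X}{\sigma_X}+\frac{\mu_Y}{\sigma_Y}\bigg)^2-sV_2,$$ where $V_2\sim\chi_n'^2(\lambda_-)$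 with $\lambda_-=n(\mu_X/\sigma_X-\mu_Y/\sigma_Y)^2/4$.
   Context: $=_d$ denotes equality in distribution. For a positive integer $r$, the noncentral chi-square distribution $\chi_r'^2(\lambda)$ with $r$ degrees of freedom and noncentrality parameter $\lambda\geq0$ is the distribution of $\sum_{i=1}^r X_i^2$, where $X_i\sim N(\mu_i,1)$, $i=1,\ldots,r$, are independent and $\lambda=\sum_{i=1}^r\mu_i^2$. The case $\lambda=0$ is the chi-square distribution with $r$ degrees of freedom. *)

theory Defs
  imports "HOL-Probability.Probability"
begin

definition eq_in_distr :: "'a measure \<Rightarrow> ('a \<Rightarrow> real) \<Rightarrow> 'b measure \<Rightarrow> ('b \<Rightarrow> real) \<Rightarrow> bool" where
  "eq_in_distr M X N Y \<longleftrightarrow>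
     X \<in> borel_measurable M \<and> Y \<in> borel_measurable N \<and> distr M borel X = distr N borel Y"

definition covariance :: "'a measure \<Rightarrow> ('a \<Rightarrow> real) \<Rightarrow> ('a \<Rightarrow> real) \<Rightarrow> real" where
  "covariance M X Y =
     prob_space.expectation M (\<lambda>\<omega>. (X \<omega> - prob_space.expectation M X) * (Y \<omega> - prob_space.expectation M Y))"

definition correlation :: "'a measure \<Rightarrow> ('a \<Rightarrow> real) \<Rightarrow> ('a \<Rightarrow> real) \<Rightarrow> real" where
  "correlation M X Y =
     covariance M X Y / (sqrt (prob_space.variance M X) * sqrt (prob_space.variance M Y))"

text \<open>
  A random vector is (jointly) normal if it has the law of an affine image of a vector of
  independent standard normals. The matrix may be singular, so degenerate normal vectors
  (correlation 1 or -1) are included. Means, variances and correlation are not parameters here;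
  they are to be prescribed as actual moments.
\<close>

definition bivariate_normal :: "'a measure \<Rightarrow> ('a \<Rightarrow> real) \<Rightarrow> ('a \<Rightarrow> real) \<Rightarrow> bool" where
  "bivariate_normal M X Y \<longleftrightarrow>
     X \<in> borel_measurable M \<and> Y \<in> borel_measurable M \<and>
     (\<exists>m\<^sub>1 m\<^sub>2 a b c d :: real.
        distr M (borel \<Otimes>\<^sub>M borel) (\<lambda>\<omega>. (X \<omega>, Y \<omega>)) =
        distr (std_normal_distribution \<Otimes>\<^sub>M std_normal_distribution) (borel \<Otimes>\<^sub>M borel)
          (\<lambda>(u, w). (m\<^sub>1 + a * u + b * w, m\<^sub>2 + c * u + d * w)))"

text \<open>
  The law with \<open>r\<close> degrees of freedom and noncentrality \<open>l\<close> depends on the means only through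
  the sum of their squares; the definition does not presuppose this and accepts every choice of
  means. The product measure encodes independence of the \<open>X\<^sub>i \<sim> N(\<mu> i, 1)\<close>.
\<close>

definition noncentral_chi_square :: "nat \<Rightarrow> real \<Rightarrow> real measure \<Rightarrow> bool" where
  "noncentral_chi_square r l D \<longleftrightarrow> 0 < r \<and>
     (\<exists>\<mu> :: nat \<Rightarrow> real. l = (\<Sum>i=1..r. (\<mu> i)\<^sup>2) \<and>
        D = distr (Pi\<^sub>M {1..r} (\<lambda>i. density lborel (normal_density (\<mu> i) 1))) borel
              (\<lambda>x. \<Sum>i=1..r. (x i)\<^sup>2))"

definition noncentral_chi_square_rv :: "'a measure \<Rightarrow> ('a \<Rightarrow> real) \<Rightarrow> nat \<Rightarrow> real \<Rightarrow> bool" where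
  "noncentral_chi_square_rv M V r l \<longleftrightarrow>
     V \<in> borel_measurable M \<and> noncentral_chi_square r l (distr M borel V)"

lemma noncentral_chi_square_exists:
  assumes "0 < r" "0 \<le> l"
  shows "\<exists>D. noncentral_chi_square r l D"
proof -
  have "l = (\<Sum>i=1..r. ((if i = 1 then sqrt l else 0 :: real))\<^sup>2)"
    using assms by (simp add: if_distrib[of "\<lambda>x. x\<^sup>2"] sum.delta cong: if_cong)
  then show ?thesis
    unfolding noncentral_chi_square_def using assms(1)
    by (intro exI conjI) auto
qed

lemma noncentral_chi_square_prob_space:
  assumes "noncentral_chi_square r l D"
  shows "prob_space D" and "sets D = sets borel"
proof -
  obtain \<mu> :: "nat \<Rightarrow> real" where D:
    "D = distr (Pi\<^sub>M {1..r} (\<lambda>i. density lborel (normal_density (\<mu> i) 1))) borel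
           (\<lambda>x. \<Sum>i=1..r. (x i)\<^sup>2)"
    using assms unfolding noncentral_chi_square_def by blast
  have meas: "(\<lambda>x. \<Sum>i=1..r. (x i)\<^sup>2) \<in>
      borel_measurable (Pi\<^sub>M {1..r} (\<lambda>i. density lborel (normal_density (\<mu> i) 1)))"
  proof (intro borel_measurable_sum borel_measurable_power)
    fix i assume "i \<in> {1..r}"
    then have "(\<lambda>x. x i) \<in> measurable
        (Pi\<^sub>M {1..r} (\<lambda>i. density lborel (normal_density (\<mu> i) 1)))
        (density lborel (normal_density (\<mu> i) 1))"
      by (rule measurable_component_singleton)
    then show "(\<lambda>x. x i) \<in> borel_measurable
        (Pi\<^sub>M {1..r} (\<lambda>i. density lborel (normal_density (\<mu> i) 1)))"
      by (simp cong: measurable_cong_sets)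
  qed
  show "prob_space D"
    unfolding D
    by (intro prob_space.prob_space_distr prob_space_PiM meas prob_space_normal_density) simp_all
  show "sets D = sets borel"
    unfolding D by simp
qed

lemma independent_noncentral_chi_square_exists:
  assumes "0 < r" "0 \<le> l" "0 \<le> l'"
  shows "\<exists>(N :: (real \<times> real) measure) V W. prob_space N \<and> prob_space.indep_var N borel V borel W \<and>
           noncentral_chi_square_rv N V r l \<and> noncentral_chi_square_rv N W r l'"
proof -
  obtain D where D: "noncentral_chi_square r l D"
    using noncentral_chi_square_exists assms by blast
  obtain D' where D': "noncentral_chi_square r l' D'"
    using noncentral_chi_square_exists assms by blast
  note d = noncentral_chi_square_prob_space[OF D]
  note d' = noncentral_chi_square_prob_space[OF D']
  interpret D: prob_space D by (rule d)
  interpret D': prob_space D' by (rule d')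
  interpret P: pair_prob_space D D' ..
  have m1: "fst \<in> borel_measurable (D \<Otimes>\<^sub>M D')" and m2: "snd \<in> borel_measurable (D \<Otimes>\<^sub>M D')"
    using d(2) d'(2) by (auto simp: measurable_fst measurable_snd cong: measurable_cong_sets)
  have e1: "distr (D \<Otimes>\<^sub>M D') borel fst = D"
    using D'.distr_pair_fst[of D] d(2) by (simp cong: distr_cong)
  have "distr (D \<Otimes>\<^sub>M D') D' snd = distr (distr (D' \<Otimes>\<^sub>M D) (D \<Otimes>\<^sub>M D') (\<lambda>(x, y). (y, x))) D' snd"
    by (subst P.distr_pair_swap) (simp add: split_def)
  also have "\<dots> = distr (D' \<Otimes>\<^sub>M D) D' fst"
    by (subst distr_distr) (auto intro!: distr_cong simp: comp_def split_def)
  also have "\<dots> = D'"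
    by (rule D.distr_pair_fst)
  finally have e2: "distr (D \<Otimes>\<^sub>M D') borel snd = D'"
    using d'(2) by (simp cong: distr_cong)
  have "P.indep_var borel fst borel snd"
    unfolding P.indep_var_distribution_eq using m1 m2 e1 e2 d(2) d'(2)
    by (auto simp: distr_id2[OF sets_pair_measure_cong])
  moreover have "noncentral_chi_square_rv (D \<Otimes>\<^sub>M D') fst r l"
    unfolding noncentral_chi_square_rv_def using m1 e1 D by simp
  moreover have "noncentral_chi_square_rv (D \<Otimes>\<^sub>M D') snd r l'"
    unfolding noncentral_chi_square_rv_def using m2 e2 D' by simp
  ultimately show ?thesis
    using P.prob_space_axioms by blast
qed

end

theory Submission
  imports Defs
begin

text \<open>
  With \<open>X' = X / \<sigma>\<^sub>X\<close> and \<open>Y' = Y / \<sigma>\<^sub>Y\<close> the polarization identity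
  \<open>X Y = (s / 4) ((X' + Y')\<^sup>2 - (X' - Y')\<^sup>2)\<close> turns the product into a difference of two squares.
  Since \<open>X'\<close> and \<open>Y'\<close> both have variance 1, the sum and the difference are uncorrelated, with
  variances \<open>2 (1 + \<rho>)\<close> and \<open>2 (1 - \<rho>)\<close>. They are jointly normal, hence independent: a pair of
  orthogonal linear forms in two independent standard normals has the same law as a pair of multiples
  of the two coordinates, because the standard normal law on the plane is invariant under orthogonal maps
  (\<open>std_normal_pair_rotation\<close>, \<open>std_normal_pair_orthogonal_forms\<close>). So the characteristic function of
  \<open>X Y\<close> is the product of those of two squared normal variables
  (\<open>char_bivariate_normal_product\<close>). If \<open>\<rho> = 1\<close> or \<open>\<rho> = -1\<close>, one of the two squares is a constant,
  which becomes the additive shift in the degenerate cases.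

  The characteristic function of \<open>S\<^sub>n\<close> is the \<open>n\<close>-th power of that product. It remains to recognize
  the \<open>n\<close>-th power of the characteristic function of \<open>(m + U)\<^sup>2\<close>, \<open>U\<close> standard normal, as the
  characteristic function of any noncentral chi-square law with \<open>n\<close> degrees of freedom and noncentrality
  \<open>n m\<^sup>2\<close>, whichever means with this sum of squares define the law (\<open>char_noncentral_chi_square\<close>).
  The reason is again rotation invariance: a rotation that moves the mean vector \<open>(a, b)\<close> to the
  first axis gives the functional equation \<open>shifted_square_char_mult\<close>, by which a product of such
  functions depends on the means only through their number and the sum of their squares. Equality in
  distribution then follows from the uniqueness theorem of Levy.
\<close>

section \<open>Rotation invariance of the standard normal law on the plane\<close>

lemma measurable_std_normal_pair:
  "f \<in> measurable (std_normal_distribution \<Otimes>\<^sub>M std_normal_distribution) N \<longleftrightarrow>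
   f \<in> measurable (borel \<Otimes>\<^sub>M borel) N"
  by (simp add: measurable_cong_sets[OF sets_pair_measure_cong[of std_normal_distribution borel
        std_normal_distribution borel] refl])

lemma std_normal_pair_nn_integral:
  fixes f :: "real \<times> real \<Rightarrow> ennreal"
  assumes [measurable]: "f \<in> borel_measurable (borel \<Otimes>\<^sub>M borel)"
  shows "(\<integral>\<^sup>+z. f z \<partial>(std_normal_distribution \<Otimes>\<^sub>M std_normal_distribution)) =
    (\<integral>\<^sup>+x. \<integral>\<^sup>+y. f (x, y) * ennreal (exp (- (x\<^sup>2 + y\<^sup>2) / 2) / (2 * pi)) \<partial>lborel \<partial>lborel)"
proof -
  interpret S: prob_space std_normal_distribution
    by (simp add: prob_space_normal_density)
  have dens: "ennreal (std_normal_density x) * ennreal (std_normal_density y) =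
      ennreal (exp (- (x\<^sup>2 + y\<^sup>2) / 2) / (2 * pi))" for x y
    by (simp add: std_normal_density_def ennreal_mult[symmetric] field_simps flip: exp_add)
  have "(\<integral>\<^sup>+z. f z \<partial>(std_normal_distribution \<Otimes>\<^sub>M std_normal_distribution)) =
     (\<integral>\<^sup>+x. \<integral>\<^sup>+y. f (x, y) \<partial>std_normal_distribution \<partial>std_normal_distribution)"
    by (subst S.nn_integral_fst) (simp_all add: measurable_std_normal_pair)
  also have "\<dots> = (\<integral>\<^sup>+x. ennreal (std_normal_density x) *
       (\<integral>\<^sup>+y. ennreal (std_normal_density y) * f (x, y) \<partial>lborel) \<partial>lborel)"
    by (simp add: nn_integral_density)
  also have "\<dots> = (\<integral>\<^sup>+x. \<integral>\<^sup>+y. f (x, y) * (ennreal (std_normal_density x) * ennreal (std_normal_density y)) \<partial>lborel \<partial>lborel)"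
    by (subst nn_integral_cmult[symmetric]) (auto simp: ac_simps)
  finally show ?thesis
    unfolding dens .
qed

text \<open>
  The joint density depends on \<open>x\<^sup>2 + y\<^sup>2\<close> only, and an orthogonal map preserves this quantity as well
  as the area. The invariance of the area comes from two one-dimensional affine substitutions.
  The identity map on the right-hand side presents the law of the pair as a distribution on the Borel sets
  of the plane, so that both sides can be transported further in the same way.
\<close>

lemma std_normal_pair_rotation:
  fixes p q r s :: real
  assumes pq: "p\<^sup>2 + q\<^sup>2 = 1" and rs: "r\<^sup>2 + s\<^sup>2 = 1" and orth: "p * r + q * s = 0"
  shows "distr (std_normal_distribution \<Otimes>\<^sub>M std_normal_distribution) (borel \<Otimes>\<^sub>M borel)
      (\<lambda>(u, w). (p * u + q * w, r * u + s * w)) =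
    distr (std_normal_distribution \<Otimes>\<^sub>M std_normal_distribution) (borel \<Otimes>\<^sub>M borel) (\<lambda>z. z)"
    (is "distr ?S ?B ?h = _")
proof -
  have det: "(p * s - q * r)\<^sup>2 = 1"
  proof -
    have "(p * s - q * r)\<^sup>2 = (p\<^sup>2 + q\<^sup>2) * (r\<^sup>2 + s\<^sup>2) - (p * r + q * s)\<^sup>2"
      by algebra
    then show ?thesis using assms by simp
  qed
  define d where "d = p * s - q * r"
  \<comment> \<open>The second row is the first one turned by a right angle, up to the sign \<open>d\<close>; hence the columns
    are orthonormal, too.\<close>
  have "s = s * (p\<^sup>2 + q\<^sup>2) - q * (p * r + q * s)" "r = r * (p\<^sup>2 + q\<^sup>2) - p * (p * r + q * s)"
    using pq orth by simp_all
  then have "s = d * p" "r = - d * q"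
    by (simp_all add: d_def power2_eq_square algebra_simps)
  moreover have "d\<^sup>2 = 1" "d * d = 1"
    using det by (simp_all add: d_def power2_eq_square)
  ultimately have cols: "p\<^sup>2 + r\<^sup>2 = 1" "q\<^sup>2 + s\<^sup>2 = 1" "p * q + r * s = 0"
    using pq by (simp_all add: power_mult_distrib add.commute)
  have norm: "(p * u + q * w)\<^sup>2 + (r * u + s * w)\<^sup>2 = u\<^sup>2 + w\<^sup>2" for u w
  proof -
    have "(p * u + q * w)\<^sup>2 + (r * u + s * w)\<^sup>2 =
        (p\<^sup>2 + r\<^sup>2) * u\<^sup>2 + (q\<^sup>2 + s\<^sup>2) * w\<^sup>2 + 2 * (p * q + r * s) * u * w"
      by algebra
    then show ?thesis using cols by simp
  qed
  have "(\<integral>\<^sup>+z. f (?h z) \<partial>?S) = (\<integral>\<^sup>+z. f z \<partial>?S)"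
    if [measurable]: "f \<in> borel_measurable ?B" for f :: "real \<times> real \<Rightarrow> ennreal"
  proof -
    define g where "g = (\<lambda>x y. f (x, y) * ennreal (exp (- (x\<^sup>2 + y\<^sup>2) / 2) / (2 * pi)))"
    have [measurable]: "case_prod g \<in> borel_measurable ?B"
      unfolding g_def by measurable
    have "(\<integral>\<^sup>+z. f (?h z) \<partial>?S) =
        (\<integral>\<^sup>+u. \<integral>\<^sup>+w. f (?h (u, w)) * ennreal (exp (- (u\<^sup>2 + w\<^sup>2) / 2) / (2 * pi)) \<partial>lborel \<partial>lborel)"
      by (rule std_normal_pair_nn_integral) measurable
    also have "\<dots> = (\<integral>\<^sup>+u. \<integral>\<^sup>+w. g (p * u + q * w) (r * u + s * w) \<partial>lborel \<partial>lborel)"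
      unfolding g_def norm by simp
    also have "\<dots> = (\<integral>\<^sup>+x. \<integral>\<^sup>+y. g x y \<partial>lborel \<partial>lborel)"
    proof (cases "p = 0")
      case False
      \<comment> \<open>First \<open>y = (r / p) x + c w\<close> for fixed \<open>x\<close>, then \<open>x = q w + p u\<close> for fixed \<open>w\<close>.
        This \<open>c\<close> makes the second coordinate \<open>r u + s w\<close>; the Jacobian is \<open>p c\<close>, the
        determinant.\<close>
      define c where "c = (p * s - q * r) / p"
      have c: "c \<noteq> 0" "\<bar>p\<bar> * \<bar>c\<bar> = 1"
        using False det by (auto simp: c_def power2_eq_1_iff abs_divide)
      have y: "r / p * (q * w + p * u) + c * w = r * u + s * w" for u w
        using False by (simp add: c_def field_simps)
      have "(\<integral>\<^sup>+x. \<integral>\<^sup>+y. g x y \<partial>lborel \<partial>lborel) =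
          (\<integral>\<^sup>+x. \<bar>c\<bar> * (\<integral>\<^sup>+w. g x (r / p * x + c * w) \<partial>lborel) \<partial>lborel)"
        by (intro nn_integral_cong nn_integral_real_affine c) simp
      also have "\<dots> = \<bar>c\<bar> * (\<integral>\<^sup>+x. \<integral>\<^sup>+w. g x (r / p * x + c * w) \<partial>lborel \<partial>lborel)"
        by (rule nn_integral_cmult) measurable
      also have "\<dots> = \<bar>c\<bar> * (\<integral>\<^sup>+w. \<integral>\<^sup>+x. g x (r / p * x + c * w) \<partial>lborel \<partial>lborel)"
        by (subst lborel_pair.Fubini') simp_all
      also have "(\<integral>\<^sup>+w. \<integral>\<^sup>+x. g x (r / p * x + c * w) \<partial>lborel \<partial>lborel) =
          (\<integral>\<^sup>+w. \<bar>p\<bar> * (\<integral>\<^sup>+u. g (q * w + p * u) (r / p * (q * w + p * u) + c * w) \<partial>lborel) \<partial>lborel)"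
        by (intro nn_integral_cong nn_integral_real_affine False) simp
      also have "\<dots> = \<bar>p\<bar> * (\<integral>\<^sup>+w. \<integral>\<^sup>+u. g (p * u + q * w) (r * u + s * w) \<partial>lborel \<partial>lborel)"
        unfolding y by (subst nn_integral_cmult) (simp_all add: add.commute)
      also have "(\<integral>\<^sup>+w. \<integral>\<^sup>+u. g (p * u + q * w) (r * u + s * w) \<partial>lborel \<partial>lborel) =
          (\<integral>\<^sup>+u. \<integral>\<^sup>+w. g (p * u + q * w) (r * u + s * w) \<partial>lborel \<partial>lborel)"
        by (subst lborel_pair.Fubini') simp_all
      finally have "(\<integral>\<^sup>+x. \<integral>\<^sup>+y. g x y \<partial>lborel \<partial>lborel) = ennreal \<bar>c\<bar> * (ennreal \<bar>p\<bar> *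
          (\<integral>\<^sup>+u. \<integral>\<^sup>+w. g (p * u + q * w) (r * u + s * w) \<partial>lborel \<partial>lborel))" .
      moreover have "ennreal \<bar>c\<bar> * ennreal \<bar>p\<bar> = 1"
        using c(2) by (simp add: mult.commute flip: ennreal_mult)
      ultimately show ?thesis
        by (simp add: mult.assoc[symmetric])
    next
      case True
      then have "q \<noteq> 0" "\<bar>q\<bar> = 1" "s = 0" "r \<noteq> 0" "\<bar>r\<bar> = 1"
        using assms by (auto simp: power2_eq_1_iff)
      have "(\<integral>\<^sup>+y. g x y \<partial>lborel) = (\<integral>\<^sup>+u. g x (r * u) \<partial>lborel)" for x
        using \<open>r \<noteq> 0\<close> \<open>\<bar>r\<bar> = 1\<close> by (subst nn_integral_real_affine[of _ r 0]) simp_all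
      then have "(\<integral>\<^sup>+x. \<integral>\<^sup>+y. g x y \<partial>lborel \<partial>lborel) =
          (\<integral>\<^sup>+x. \<integral>\<^sup>+u. g x (r * u) \<partial>lborel \<partial>lborel)"
        by simp
      also have "\<dots> = (\<integral>\<^sup>+w. \<integral>\<^sup>+u. g (q * w) (r * u) \<partial>lborel \<partial>lborel)"
        using \<open>q \<noteq> 0\<close> \<open>\<bar>q\<bar> = 1\<close>
        by (subst nn_integral_real_affine[of _ q 0]) simp_all
      also have "\<dots> = (\<integral>\<^sup>+u. \<integral>\<^sup>+w. g (q * w) (r * u) \<partial>lborel \<partial>lborel)"
        by (subst lborel_pair.Fubini') simp_all
      finally show ?thesis
        using True \<open>s = 0\<close> by simp
    qed
    also have "\<dots> = (\<integral>\<^sup>+z. f z \<partial>?S)"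
      by (subst std_normal_pair_nn_integral) (simp_all add: g_def)
    finally show ?thesis .
  qed
  note invariant = this
  have meas: "?h \<in> measurable ?S ?B" "(\<lambda>z. z) \<in> measurable ?S ?B"
    by (simp_all add: measurable_std_normal_pair)
  show ?thesis
  proof (rule measure_eqI)
    fix A assume "A \<in> sets (distr ?S ?B ?h)"
    then have A: "A \<in> sets ?B" by simp
    then have ind: "indicator A \<in> borel_measurable ?B" by simp
    have law: "emeasure (distr ?S ?B k) A = (\<integral>\<^sup>+z. indicator A (k z) \<partial>?S)"
      if k: "k \<in> measurable ?S ?B" for k
    proof -
      have "emeasure (distr ?S ?B k) A = (\<integral>\<^sup>+z. indicator A z \<partial>distr ?S ?B k)"
        by (rule nn_integral_indicator[symmetric]) (simp add: A)
      then show ?thesis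
        using nn_integral_distr[OF k, of "indicator A"] ind by (simp cong: measurable_cong_sets)
    qed
    show "emeasure (distr ?S ?B ?h) A = emeasure (distr ?S ?B (\<lambda>z. z)) A"
      unfolding law[OF meas(1)] law[OF meas(2)] by (rule invariant[OF ind])
  qed simp
qed

text \<open>
  For nonzero coefficient vectors the map is a rotation or reflection followed by a scaling of each axis.
  A zero vector is a zero multiple of a unit vector orthogonal to the other one, so the degenerate cases
  have the same form.
\<close>

lemma std_normal_pair_orthogonal_forms:
  fixes p q r s :: real
  assumes orth: "p * r + q * s = 0"
  shows "distr (std_normal_distribution \<Otimes>\<^sub>M std_normal_distribution) (borel \<Otimes>\<^sub>M borel)
      (\<lambda>(u, w). (p * u + q * w, r * u + s * w)) =
    distr (std_normal_distribution \<Otimes>\<^sub>M std_normal_distribution) (borel \<Otimes>\<^sub>M borel)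
      (\<lambda>(u, w). (sqrt (p\<^sup>2 + q\<^sup>2) * u, sqrt (r\<^sup>2 + s\<^sup>2) * w))"
    (is "distr ?S ?B ?h = _")
proof -
  define e f where "e = sqrt (p\<^sup>2 + q\<^sup>2)" and "f = sqrt (r\<^sup>2 + s\<^sup>2)"
  have e2: "e\<^sup>2 = p\<^sup>2 + q\<^sup>2" and f2: "f\<^sup>2 = r\<^sup>2 + s\<^sup>2"
    by (simp_all add: e_def f_def)
  have p: "e * (p / e) = p" "e * (q / e) = q"
    using e2 by (cases "e = 0"; simp add: sum_power2_eq_zero_iff)+
  have r: "f * (r / f) = r" "f * (s / f) = s"
    using f2 by (cases "f = 0"; simp add: sum_power2_eq_zero_iff)+
  have ne: "(p / e)\<^sup>2 + (q / e)\<^sup>2 = 1" if "e \<noteq> 0"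
    unfolding power_divide add_divide_distrib[symmetric] e2[symmetric] using that by simp
  have nf: "(r / f)\<^sup>2 + (s / f)\<^sup>2 = 1" if "f \<noteq> 0"
    unfolding power_divide add_divide_distrib[symmetric] f2[symmetric] using that by simp
  have "\<exists>p' q' r' s'. p'\<^sup>2 + q'\<^sup>2 = 1 \<and> r'\<^sup>2 + s'\<^sup>2 = 1 \<and> p' * r' + q' * s' = 0 \<and>
      e * p' = p \<and> e * q' = q \<and> f * r' = r \<and> f * s' = s"
  proof (cases "e = 0")
    case e: False
    show ?thesis
    proof (cases "f = 0")
      case False
      have "p / e * (r / f) + q / e * (s / f) = (p * r + q * s) / (e * f)"
        by (simp only: times_divide_times_eq add_divide_distrib)
      then have "p / e * (r / f) + q / e * (s / f) = 0"
        unfolding orth by simp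
      then show ?thesis
        using ne[OF e] nf[OF False] p r by blast
    next
      case True
      have "(- (q / e))\<^sup>2 + (p / e)\<^sup>2 = 1" "p / e * - (q / e) + q / e * (p / e) = 0"
        using ne[OF e] by (simp_all add: add.commute)
      moreover have "f * - (q / e) = r" "f * (p / e) = s"
        using True r by simp_all
      ultimately show ?thesis
        using ne[OF e] p by blast
    qed
  next
    case e: True
    show ?thesis
    proof (cases "f = 0")
      case False
      have "(- (s / f))\<^sup>2 + (r / f)\<^sup>2 = 1" "- (s / f) * (r / f) + r / f * (s / f) = 0"
        using nf[OF False] by (simp_all add: add.commute)
      moreover have "e * - (s / f) = p" "e * (r / f) = q"
        using e p by simp_all
      ultimately show ?thesis
        using nf[OF False] r by blast
    next
      case True
      then show ?thesis
        using e p r by (intro exI[of _ 1] exI[of _ 0]) simp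
    qed
  qed
  then obtain p' q' r' s' where unit: "p'\<^sup>2 + q'\<^sup>2 = 1" "r'\<^sup>2 + s'\<^sup>2 = 1" "p' * r' + q' * s' = 0"
    and scale: "e * p' = p" "e * q' = q" "f * r' = r" "f * s' = s"
    by blast
  have meas: "(\<lambda>(u, w). (p' * u + q' * w, r' * u + s' * w)) \<in> measurable ?S ?B"
      "(\<lambda>z. z) \<in> measurable ?S ?B"
    by (simp_all add: measurable_std_normal_pair)
  define k where "k = (\<lambda>(u, w). (e * u, f * w))"
  have k: "k \<in> measurable ?B ?B"
    unfolding k_def by measurable
  have "k \<circ> (\<lambda>(u, w). (p' * u + q' * w, r' * u + s' * w)) = ?h"
    by (simp add: k_def fun_eq_iff distrib_left mult.assoc[symmetric] scale)
  then have "distr ?S ?B ?h = distr (distr ?S ?B (\<lambda>(u, w). (p' * u + q' * w, r' * u + s' * w))) ?B k"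
    unfolding distr_distr[OF k meas(1)] by (rule arg_cong[OF sym])
  also have "\<dots> = distr ?S ?B (k \<circ> (\<lambda>z. z))"
    unfolding std_normal_pair_rotation[OF unit] by (rule distr_distr[OF k meas(2)])
  finally show ?thesis
    unfolding comp_def k_def e_def f_def .
qed

section \<open>Characteristic functions of noncentral chi-square laws\<close>

lemma prob_space_std_normal: "prob_space std_normal_distribution"
  by (simp add: prob_space_normal_density)

lemma std_normal_pair_integral_mult:
  fixes f g :: "real \<Rightarrow> 'a::{real_normed_field,banach,second_countable_topology}"
  assumes f: "integrable std_normal_distribution f" and g: "integrable std_normal_distribution g"
  shows "has_bochner_integral (std_normal_distribution \<Otimes>\<^sub>M std_normal_distribution)
      (\<lambda>(u, w). f u * g w)
      (integral\<^sup>L std_normal_distribution f * integral\<^sup>L std_normal_distribution g)"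
proof -
  let ?S = std_normal_distribution
  interpret S: prob_space ?S by (rule prob_space_std_normal)
  interpret SS: pair_prob_space ?S ?S ..
  have [measurable]: "f \<in> borel_measurable borel" "g \<in> borel_measurable borel"
    using f g by (auto dest!: borel_measurable_integrable)
  have int: "integrable (?S \<Otimes>\<^sub>M ?S) (\<lambda>(u, w). f u * g w)"
  proof (rule SS.Fubini_integrable)
    show "(\<lambda>(u, w). f u * g w) \<in> borel_measurable (?S \<Otimes>\<^sub>M ?S)"
      by (simp add: measurable_std_normal_pair)
    show "integrable ?S (\<lambda>u. \<integral>w. norm (case (u, w) of (u, w) \<Rightarrow> f u * g w) \<partial>?S)"
      using f g by (simp add: norm_mult)
    show "AE u in ?S. integrable ?S (\<lambda>w. case (u, w) of (u, w) \<Rightarrow> f u * g w)"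
      using g by simp
  qed
  then have "integral\<^sup>L (?S \<Otimes>\<^sub>M ?S) (\<lambda>(u, w). f u * g w) = (\<integral>u. \<integral>w. f u * g w \<partial>?S \<partial>?S)"
    by (subst SS.integral_fst[symmetric]) simp_all
  also have "\<dots> = integral\<^sup>L ?S f * integral\<^sup>L ?S g"
    by simp
  finally show ?thesis
    using int by (simp add: has_bochner_integral_iff)
qed

text \<open>
  The characteristic function at \<open>t\<close> of the noncentral chi-square law with one degree of freedom
  and noncentrality \<open>m\<^sup>2\<close>.
\<close>

definition shifted_square_char :: "real \<Rightarrow> real \<Rightarrow> complex" where
  "shifted_square_char m t = (CLINT u|std_normal_distribution. iexp (t * (m + u)\<^sup>2))"

lemma integrable_std_normal_iexp:
  assumes [measurable]: "f \<in> borel_measurable borel"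
  shows "integrable std_normal_distribution (\<lambda>u. iexp (f u))"
  by (rule prob_space.integrable_iexp[OF prob_space_std_normal]) auto

lemma normal_distribution_eq_shift:
  "density lborel (normal_density m 1) = distr std_normal_distribution borel (\<lambda>u. m + u)"
proof -
  interpret S: prob_space std_normal_distribution by (rule prob_space_std_normal)
  have "distributed std_normal_distribution lborel (\<lambda>u. u) std_normal_density"
    by (simp add: distributed_def distr_id2)
  from S.normal_density_affine[OF this, of 1 m]
  have "distr std_normal_distribution lborel (\<lambda>u. m + u) = density lborel (normal_density m 1)"
    by (simp add: distributed_def)
  then show ?thesis
    by (metis distr_cong sets_lborel)
qed

lemma char_normal_square:
  "(CLINT x|density lborel (normal_density m 1). iexp (t * x\<^sup>2)) = shifted_square_char m t"
  unfolding normal_distribution_eq_shift[of m] shifted_square_char_def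
  by (subst integral_distr) simp_all

text \<open>
  The left-hand side is the characteristic function of the squared length of a standard normal vector
  shifted by \<open>(a, b)\<close>. Rotating the plane so that \<open>(a, b)\<close> becomes \<open>(sqrt (a\<^sup>2 + b\<^sup>2), 0)\<close> changes
  neither the length nor the law of the normal vector.
\<close>

lemma shifted_square_char_mult:
  "shifted_square_char a t * shifted_square_char b t =
   shifted_square_char (sqrt (a\<^sup>2 + b\<^sup>2)) t * shifted_square_char 0 t"
proof (cases "a = 0 \<and> b = 0")
  case False
  let ?S = "std_normal_distribution \<Otimes>\<^sub>M std_normal_distribution"
  let ?B = "borel \<Otimes>\<^sub>M borel :: (real \<times> real) measure"
  define R where "R = sqrt (a\<^sup>2 + b\<^sup>2)"
  have R2: "R\<^sup>2 = a\<^sup>2 + b\<^sup>2" by (simp add: R_def)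
  have R: "R \<noteq> 0" using False R2 by (auto simp: sum_power2_eq_zero_iff)
  have unit: "(a / R)\<^sup>2 + (b / R)\<^sup>2 = 1" "(- b / R)\<^sup>2 + (a / R)\<^sup>2 = 1"
    "a / R * (- b / R) + b / R * (a / R) = 0"
    using R by (simp_all add: power_divide R2[symmetric] add.commute flip: add_divide_distrib)
  have product: "shifted_square_char p t * shifted_square_char q t =
      (CLINT (u, w)|?S. iexp (t * ((p + u)\<^sup>2 + (q + w)\<^sup>2)))" for p q
  proof -
    have "(CLINT (u, w)|?S. iexp (t * ((p + u)\<^sup>2 + (q + w)\<^sup>2))) =
        (CLINT (u, w)|?S. iexp (t * (p + u)\<^sup>2) * iexp (t * (q + w)\<^sup>2))"
      by (simp add: distrib_left exp_add)
    also have "\<dots> = shifted_square_char p t * shifted_square_char q t"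
      unfolding shifted_square_char_def
      by (intro has_bochner_integral_integral_eq std_normal_pair_integral_mult
          integrable_std_normal_iexp) simp_all
    finally show ?thesis by simp
  qed
  have rotate: "(a + u)\<^sup>2 + (b + w)\<^sup>2 =
      (R + (a / R * u + b / R * w))\<^sup>2 + (0 + (- b / R * u + a / R * w))\<^sup>2" for u w
  proof -
    have "(R + (a / R * u + b / R * w))\<^sup>2 + (0 + (- b / R * u + a / R * w))\<^sup>2 =
        R\<^sup>2 + 2 * (R * (a / R) * u + R * (b / R) * w) + ((a / R)\<^sup>2 + (b / R)\<^sup>2) * (u\<^sup>2 + w\<^sup>2)"
      unfolding minus_divide_left[symmetric] by algebra
    also have "\<dots> = (a\<^sup>2 + b\<^sup>2) + 2 * (a * u + b * w) + (u\<^sup>2 + w\<^sup>2)"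
      unfolding unit R2[symmetric] using R by simp
    also have "\<dots> = (a + u)\<^sup>2 + (b + w)\<^sup>2"
      by algebra
    finally show ?thesis by simp
  qed
  define h where "h = (\<lambda>(u, w). (a / R * u + b / R * w, - b / R * u + a / R * w))"
  define F where "F = (\<lambda>(x, y). iexp (t * ((R + x)\<^sup>2 + (0 + y)\<^sup>2)))"
  have [measurable]: "h \<in> measurable ?B ?B" "F \<in> borel_measurable ?B"
    by (simp_all add: h_def F_def)
  have "shifted_square_char a t * shifted_square_char b t = integral\<^sup>L ?S (\<lambda>z. F (h z))"
    unfolding product rotate by (simp add: F_def h_def split_def)
  also have "\<dots> = integral\<^sup>L (distr ?S ?B h) F"
    by (subst integral_distr) (simp_all add: measurable_std_normal_pair)
  also have "\<dots> = integral\<^sup>L ?S F"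
    unfolding h_def std_normal_pair_rotation[OF unit]
    by (subst integral_distr) (simp_all add: measurable_std_normal_pair)
  also have "\<dots> = shifted_square_char R t * shifted_square_char 0 t"
    by (simp add: product F_def)
  finally show ?thesis by (simp add: R_def)
qed simp

text \<open>
  The square root in the preceding lemma loses the sign of a mean; the symmetry of the normal density
  makes up for this.
\<close>

lemma shifted_square_char_minus: "shifted_square_char (- m) t = shifted_square_char m t"
proof -
  have density: "shifted_square_char m t =
      (CLINT u|lborel. std_normal_density u *\<^sub>R iexp (t * (m + u)\<^sup>2))" for m
    unfolding shifted_square_char_def by (subst integral_density) simp_all
  have "(- m + - u)\<^sup>2 = (m + u)\<^sup>2" for u
    by algebra
  then show ?thesis
    unfolding density
    by (subst lborel_integral_real_affine[of "-1" _ 0]) (simp_all add: std_normal_density_def)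
qed

lemma shifted_square_char_prod:
  assumes "finite I" "I \<noteq> {}"
  shows "(\<Prod>i\<in>I. shifted_square_char (\<mu> i) t) =
    shifted_square_char (sqrt (\<Sum>i\<in>I. (\<mu> i)\<^sup>2)) t * shifted_square_char 0 t ^ (card I - 1)"
  using assms
proof (induction rule: finite_ne_induct)
  case (singleton i)
  have "shifted_square_char \<bar>\<mu> i\<bar> t = shifted_square_char (\<mu> i) t"
    by (simp add: abs_if shifted_square_char_minus)
  then show ?case by simp
next
  case (insert i I)
  then obtain k where k: "card I = Suc k"
    by (metis card_eq_0_iff not0_implies_Suc)
  have "(\<Prod>j\<in>insert i I. shifted_square_char (\<mu> j) t) =
     (shifted_square_char (\<mu> i) t * shifted_square_char (sqrt (\<Sum>i\<in>I. (\<mu> i)\<^sup>2)) t) *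
     shifted_square_char 0 t ^ k"
    using insert k by simp
  also have "\<dots> = shifted_square_char (sqrt ((\<mu> i)\<^sup>2 + (\<Sum>i\<in>I. (\<mu> i)\<^sup>2))) t *
     shifted_square_char 0 t * shifted_square_char 0 t ^ k"
    by (simp add: sum_nonneg shifted_square_char_mult[of "\<mu> i"])
  finally show ?case
    using insert k by simp
qed

text \<open>
  The means in the representation of the law may be arbitrary with sum of squares \<open>r m\<^sup>2\<close>; by
  \<open>shifted_square_char_prod\<close> they can be exchanged for the constant mean \<open>m\<close>.
\<close>

lemma char_noncentral_chi_square:
  assumes "noncentral_chi_square r (real r * m\<^sup>2) D"
  shows "char D t = shifted_square_char m t ^ r"
proof -
  let ?N = "\<lambda>m. density lborel (normal_density m 1)"
  obtain \<mu> where r: "0 < r" and \<mu>: "real r * m\<^sup>2 = (\<Sum>i=1..r. (\<mu> i)\<^sup>2)"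
    and D: "D = distr (Pi\<^sub>M {1..r} (\<lambda>i. ?N (\<mu> i))) borel (\<lambda>x. \<Sum>i=1..r. (x i)\<^sup>2)"
    using assms unfolding noncentral_chi_square_def by blast
  interpret N: product_prob_space "\<lambda>i. ?N (\<mu> i)"
    by (intro product_prob_spaceI prob_space_normal_density) simp
  have meas: "(\<lambda>x. \<Sum>i=1..r. (x i)\<^sup>2) \<in> borel_measurable (Pi\<^sub>M {1..r} (\<lambda>i. ?N (\<mu> i)))"
  proof (intro borel_measurable_sum borel_measurable_power)
    fix i assume "i \<in> {1..r}"
    from measurable_component_singleton[OF this, of "\<lambda>i. ?N (\<mu> i)"]
    show "(\<lambda>x. x i) \<in> borel_measurable (Pi\<^sub>M {1..r} (\<lambda>i. ?N (\<mu> i)))"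
      by (simp cong: measurable_cong_sets)
  qed
  have "char D t = (CLINT x|Pi\<^sub>M {1..r} (\<lambda>i. ?N (\<mu> i)). iexp (t * (\<Sum>i=1..r. (x i)\<^sup>2)))"
    unfolding D char_def by (rule integral_distr[OF meas]) simp
  also have "\<dots> = (CLINT x|Pi\<^sub>M {1..r} (\<lambda>i. ?N (\<mu> i)). (\<Prod>i=1..r. iexp (t * (x i)\<^sup>2)))"
    by (simp add: sum_distrib_left exp_sum)
  also have "\<dots> = (\<Prod>i=1..r. CLINT x|?N (\<mu> i). iexp (t * x\<^sup>2))"
    by (intro N.product_integral_prod prob_space.integrable_iexp prob_space_normal_density) simp_all
  also have "\<dots> = (\<Prod>i=1..r. shifted_square_char (\<mu> i) t)"
    by (simp only: char_normal_square)
  also have "\<dots> = (\<Prod>i=1..r. shifted_square_char m t)"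
  proof -
    have "(\<Prod>i=1..r. shifted_square_char (\<nu> i) t) =
        shifted_square_char (sqrt (\<Sum>i=1..r. (\<nu> i)\<^sup>2)) t * shifted_square_char 0 t ^ (r - 1)" for \<nu>
      using r shifted_square_char_prod[of "{1..r}" \<nu> t] by simp
    from this[of \<mu>] this[of "\<lambda>_. m"] show ?thesis
      unfolding \<mu>[symmetric] by simp
  qed
  finally show ?thesis by simp
qed

section \<open>The product of a bivariate normal pair\<close>

lemma std_normal_pair_moments:
  fixes \<alpha> \<beta> \<gamma> \<beta>' \<gamma>' :: real
  defines "S \<equiv> std_normal_distribution \<Otimes>\<^sub>M std_normal_distribution"
  shows "has_bochner_integral S (\<lambda>(u, w). \<alpha> + \<beta> * u + \<gamma> * w) \<alpha>"
    and "has_bochner_integral S (\<lambda>(u, w). (\<beta> * u + \<gamma> * w) * (\<beta>' * u + \<gamma>' * w)) (\<beta> * \<beta>' + \<gamma> * \<gamma>')"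
proof -
  have mono: "has_bochner_integral S (\<lambda>z. fst z ^ i * snd z ^ j)
      (integral\<^sup>L std_normal_distribution (\<lambda>u. u ^ i) * integral\<^sup>L std_normal_distribution (\<lambda>u. u ^ j))"
    for i j
    using std_normal_pair_integral_mult[OF integrable_std_normal_distribution_moment
        integrable_std_normal_distribution_moment, of i j]
    by (simp add: S_def split_def)
  have m0: "integral\<^sup>L std_normal_distribution (\<lambda>u. u ^ 0) = 1"
    using std_normal_distribution_even_moments(1)[of 0] by simp
  have m1: "integral\<^sup>L std_normal_distribution (\<lambda>u. u ^ 1) = 0"
    by (rule integral_std_normal_distribution_moment_odd) simp
  have m2: "integral\<^sup>L std_normal_distribution (\<lambda>u. u ^ 2) = 1"
    using std_normal_distribution_even_moments(1)[of 1] by (simp add: fact_numeral)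
  note moments =
    mono[of 0 0, unfolded m0] mono[of 1 0, unfolded m0 m1] mono[of 0 1, unfolded m0 m1]
    mono[of 2 0, unfolded m0 m2] mono[of 1 1, unfolded m1] mono[of 0 2, unfolded m0 m2]
  have "has_bochner_integral S (\<lambda>z. \<alpha> * (fst z ^ 0 * snd z ^ 0) + \<beta> * (fst z ^ 1 * snd z ^ 0)
      + \<gamma> * (fst z ^ 0 * snd z ^ 1)) (\<alpha> * (1 * 1) + \<beta> * (0 * 1) + \<gamma> * (1 * 0))"
    by (intro has_bochner_integral_add has_bochner_integral_mult_right moments)
  then show "has_bochner_integral S (\<lambda>(u, w). \<alpha> + \<beta> * u + \<gamma> * w) \<alpha>"
    by (simp add: split_def)
  have "has_bochner_integral S (\<lambda>z. (\<beta> * \<beta>') * (fst z ^ 2 * snd z ^ 0)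
      + (\<beta> * \<gamma>' + \<gamma> * \<beta>') * (fst z ^ 1 * snd z ^ 1) + (\<gamma> * \<gamma>') * (fst z ^ 0 * snd z ^ 2))
      ((\<beta> * \<beta>') * (1 * 1) + (\<beta> * \<gamma>' + \<gamma> * \<beta>') * (0 * 0) + (\<gamma> * \<gamma>') * (1 * 1))"
    by (intro has_bochner_integral_add has_bochner_integral_mult_right moments)
  then show "has_bochner_integral S (\<lambda>(u, w). (\<beta> * u + \<gamma> * w) * (\<beta>' * u + \<gamma>' * w)) (\<beta> * \<beta>' + \<gamma> * \<gamma>')"
    by (simp add: split_def power2_eq_square algebra_simps)
qed

text \<open>
  The definition of bivariate normality leaves the affine map unspecified; its coefficients are tied to the
  actual moments here.
\<close>

lemma bivariate_normal_obtains_coefficients: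
  assumes "bivariate_normal M X Y"
  obtains a b c d :: real where
    "distr M (borel \<Otimes>\<^sub>M borel) (\<lambda>\<omega>. (X \<omega>, Y \<omega>)) =
     distr (std_normal_distribution \<Otimes>\<^sub>M std_normal_distribution) (borel \<Otimes>\<^sub>M borel)
       (\<lambda>(u, w). (prob_space.expectation M X + (a * u + b * w),
                  prob_space.expectation M Y + (c * u + d * w)))"
    "prob_space.variance M X = a\<^sup>2 + b\<^sup>2" "prob_space.variance M Y = c\<^sup>2 + d\<^sup>2"
    "covariance M X Y = a * c + b * d"
proof -
  let ?S = "std_normal_distribution \<Otimes>\<^sub>M std_normal_distribution"
  let ?B = "borel \<Otimes>\<^sub>M borel :: (real \<times> real) measure"
  obtain m\<^sub>1 m\<^sub>2 a b c d where [measurable]: "X \<in> borel_measurable M" "Y \<in> borel_measurable M"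
    and law: "distr M ?B (\<lambda>\<omega>. (X \<omega>, Y \<omega>)) =
      distr ?S ?B (\<lambda>(u, w). (m\<^sub>1 + a * u + b * w, m\<^sub>2 + c * u + d * w))"
    using assms unfolding bivariate_normal_def by blast
  have transfer: "(\<integral>\<omega>. g (X \<omega>, Y \<omega>) \<partial>M) =
      (\<integral>(u, w). g (m\<^sub>1 + a * u + b * w, m\<^sub>2 + c * u + d * w) \<partial>?S)"
    if [measurable]: "g \<in> borel_measurable ?B" for g :: "real \<times> real \<Rightarrow> real"
  proof -
    have "(\<integral>\<omega>. g (X \<omega>, Y \<omega>) \<partial>M) = integral\<^sup>L (distr M ?B (\<lambda>\<omega>. (X \<omega>, Y \<omega>))) g"
      by (rule integral_distr[symmetric]) measurable
    also have "\<dots> = (\<integral>z. g ((\<lambda>(u, w). (m\<^sub>1 + a * u + b * w, m\<^sub>2 + c * u + d * w)) z) \<partial>?S)"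
      unfolding law by (rule integral_distr) (simp_all add: measurable_std_normal_pair)
    finally show ?thesis
      by (simp add: split_def)
  qed
  have EX: "prob_space.expectation M X = m\<^sub>1"
    using transfer[of fst] has_bochner_integral_integral_eq[OF std_normal_pair_moments(1), of m\<^sub>1 a b]
    by simp
  have EY: "prob_space.expectation M Y = m\<^sub>2"
    using transfer[of snd] has_bochner_integral_integral_eq[OF std_normal_pair_moments(1), of m\<^sub>2 c d]
    by simp
  have "prob_space.variance M X = a\<^sup>2 + b\<^sup>2"
    unfolding EX
    using transfer[of "\<lambda>z. (fst z - m\<^sub>1)\<^sup>2"]
      has_bochner_integral_integral_eq[OF std_normal_pair_moments(2), of a b a b]
    by (simp add: power2_eq_square add.assoc)
  moreover have "prob_space.variance M Y = c\<^sup>2 + d\<^sup>2"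
    unfolding EY
    using transfer[of "\<lambda>z. (snd z - m\<^sub>2)\<^sup>2"]
      has_bochner_integral_integral_eq[OF std_normal_pair_moments(2), of c d c d]
    by (simp add: power2_eq_square add.assoc)
  moreover have "covariance M X Y = a * c + b * d"
    unfolding covariance_def EX EY
    using transfer[of "\<lambda>z. (fst z - m\<^sub>1) * (snd z - m\<^sub>2)"]
      has_bochner_integral_integral_eq[OF std_normal_pair_moments(2), of a b c d]
    by (simp add: add.assoc)
  ultimately show thesis
    using that[of a b c d] law unfolding EX EY by (simp add: add.assoc)
qed

lemma char_affine:
  assumes [measurable]: "V \<in> borel_measurable N"
  shows "char (distr N borel (\<lambda>\<omega>. a * V \<omega> + b)) t = iexp (t * b) * char (distr N borel V) (t * a)"
proof -
  have "char (distr N borel (\<lambda>\<omega>. a * V \<omega> + b)) t = (CLINT \<omega>|N. iexp (t * b) * iexp (t * a * V \<omega>))"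
    by (simp add: char_def integral_distr distrib_left exp_add mult_ac)
  also have "\<dots> = iexp (t * b) * char (distr N borel V) (t * a)"
    by (simp add: char_def integral_distr)
  finally show ?thesis .
qed

lemma integral_iexp_scaled_square:
  assumes "\<alpha> \<noteq> 0"
  shows "(CLINT u|std_normal_distribution. iexp (t * (m + \<alpha> * u)\<^sup>2)) =
    shifted_square_char (m / \<alpha>) (t * \<alpha>\<^sup>2)"
proof -
  have eq: "t * (m + \<alpha> * u)\<^sup>2 = t * \<alpha>\<^sup>2 * (m / \<alpha> + u)\<^sup>2" for u
  proof -
    have "m + \<alpha> * u = \<alpha> * (m / \<alpha> + u)"
      using assms by (simp add: distrib_left)
    then show ?thesis
      by (simp add: power_mult_distrib)
  qed
  show ?thesis
    unfolding shifted_square_char_def eq ..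
qed

text \<open>
  The two factors belong to \<open>(X' + Y')\<^sup>2\<close> and \<open>(X' - Y')\<^sup>2\<close> for the standardized variables: their
  linear parts are orthogonal forms with squared lengths \<open>2 (1 + \<rho>)\<close> and \<open>2 (1 - \<rho>)\<close>. The formula
  covers \<open>\<rho> = 1\<close> and \<open>\<rho> = -1\<close>, where one integrand is constant.
\<close>

lemma char_bivariate_normal_product:
  fixes \<sigma>\<^sub>X \<sigma>\<^sub>Y \<rho> t :: real
  assumes normal: "bivariate_normal M X Y"
    and "\<sigma>\<^sub>X > 0" "\<sigma>\<^sub>Y > 0"
    and var: "prob_space.variance M X = \<sigma>\<^sub>X\<^sup>2" "prob_space.variance M Y = \<sigma>\<^sub>Y\<^sup>2"
    and corr: "correlation M X Y = \<rho>"
  defines "s \<equiv> \<sigma>\<^sub>X * \<sigma>\<^sub>Y"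
    and "\<mu>\<^sub>X \<equiv> prob_space.expectation M X" and "\<mu>\<^sub>Y \<equiv> prob_space.expectation M Y"
  shows "char (distr M borel (\<lambda>\<omega>. X \<omega> * Y \<omega>)) t =
    (CLINT u|std_normal_distribution. iexp (t * (s / 4) * (\<mu>\<^sub>X / \<sigma>\<^sub>X + \<mu>\<^sub>Y / \<sigma>\<^sub>Y + sqrt (2 * (1 + \<rho>)) * u)\<^sup>2)) *
    (CLINT u|std_normal_distribution. iexp (- (t * (s / 4)) * (\<mu>\<^sub>X / \<sigma>\<^sub>X - \<mu>\<^sub>Y / \<sigma>\<^sub>Y + sqrt (2 * (1 - \<rho>)) * u)\<^sup>2))"
proof -
  let ?S = "std_normal_distribution \<Otimes>\<^sub>M std_normal_distribution"
  let ?B = "borel \<Otimes>\<^sub>M borel :: (real \<times> real) measure"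
  have [measurable]: "X \<in> borel_measurable M" "Y \<in> borel_measurable M"
    using normal by (simp_all add: bivariate_normal_def)
  obtain a b c d where law: "distr M ?B (\<lambda>\<omega>. (X \<omega>, Y \<omega>)) =
      distr ?S ?B (\<lambda>(u, w). (\<mu>\<^sub>X + (a * u + b * w), \<mu>\<^sub>Y + (c * u + d * w)))"
    and VX: "\<sigma>\<^sub>X\<^sup>2 = a\<^sup>2 + b\<^sup>2" and VY: "\<sigma>\<^sub>Y\<^sup>2 = c\<^sup>2 + d\<^sup>2"
    and cov: "covariance M X Y = a * c + b * d"
    by (rule bivariate_normal_obtains_coefficients[OF normal, unfolded var, folded \<mu>\<^sub>X_def \<mu>\<^sub>Y_def])
  define A B C D where "A = a / \<sigma>\<^sub>X" and "B = b / \<sigma>\<^sub>X" and "C = c / \<sigma>\<^sub>Y" and "D = d / \<sigma>\<^sub>Y"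
  have coeff: "a = \<sigma>\<^sub>X * A" "b = \<sigma>\<^sub>X * B" "c = \<sigma>\<^sub>Y * C" "d = \<sigma>\<^sub>Y * D"
    using assms(2,3) by (simp_all add: A_def B_def C_def D_def)
  have AB: "A\<^sup>2 + B\<^sup>2 = 1" and CD: "C\<^sup>2 + D\<^sup>2 = 1"
    unfolding A_def B_def C_def D_def power_divide add_divide_distrib[symmetric]
      VX[symmetric] VY[symmetric]
    using assms(2,3) by simp_all
  have ABCD: "A * C + B * D = \<rho>"
    using corr assms(2,3) unfolding correlation_def var cov
    by (simp add: A_def B_def C_def D_def add_divide_distrib)
  define e f where "e = sqrt (2 * (1 + \<rho>))" and "f = sqrt (2 * (1 - \<rho>))"
  have plus: "sqrt ((A + C)\<^sup>2 + (B + D)\<^sup>2) = e"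
  proof -
    have "(A + C)\<^sup>2 + (B + D)\<^sup>2 = (A\<^sup>2 + B\<^sup>2) + (C\<^sup>2 + D\<^sup>2) + 2 * (A * C + B * D)"
      by algebra
    then show ?thesis
      unfolding AB CD ABCD e_def by simp
  qed
  have minus: "sqrt ((A - C)\<^sup>2 + (B - D)\<^sup>2) = f"
  proof -
    have "(A - C)\<^sup>2 + (B - D)\<^sup>2 = (A\<^sup>2 + B\<^sup>2) + (C\<^sup>2 + D\<^sup>2) - 2 * (A * C + B * D)"
      by algebra
    then show ?thesis
      unfolding AB CD ABCD f_def by simp
  qed
  have orth: "(A + C) * (A - C) + (B + D) * (B - D) = 0"
  proof -
    have "(A + C) * (A - C) + (B + D) * (B - D) = (A\<^sup>2 + B\<^sup>2) - (C\<^sup>2 + D\<^sup>2)"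
      by algebra
    then show ?thesis
      unfolding AB CD by simp
  qed
  define p q where "p = \<mu>\<^sub>X / \<sigma>\<^sub>X + \<mu>\<^sub>Y / \<sigma>\<^sub>Y" and "q = \<mu>\<^sub>X / \<sigma>\<^sub>X - \<mu>\<^sub>Y / \<sigma>\<^sub>Y"
  have means: "\<mu>\<^sub>X = \<sigma>\<^sub>X * ((p + q) / 2)" "\<mu>\<^sub>Y = \<sigma>\<^sub>Y * ((p - q) / 2)"
    using assms(2,3) by (simp_all add: p_def q_def)
  define L where "L = (\<lambda>(u, w). ((A + C) * u + (B + D) * w, (A - C) * u + (B - D) * w))"
  define F where "F = (\<lambda>(x, y). iexp (t * (s / 4) * (p + x)\<^sup>2) * iexp (- (t * (s / 4)) * (q + y)\<^sup>2))"
  have L: "L \<in> measurable ?S ?B" and F: "F \<in> borel_measurable ?B"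
    by (simp_all add: L_def F_def measurable_std_normal_pair)
  have polar: "iexp (t * ((\<mu>\<^sub>X + (a * u + b * w)) * (\<mu>\<^sub>Y + (c * u + d * w)))) = F (L (u, w))" for u w
  proof -
    have "t * ((\<mu>\<^sub>X + (a * u + b * w)) * (\<mu>\<^sub>Y + (c * u + d * w))) =
      t * (s / 4) * (p + ((A + C) * u + (B + D) * w))\<^sup>2 +
      - (t * (s / 4)) * (q + ((A - C) * u + (B - D) * w))\<^sup>2"
      unfolding means coeff s_def by (simp add: field_simps power2_eq_square)
    then show ?thesis
      unfolding F_def L_def by (simp only: prod.case of_real_add distrib_left exp_add)
  qed
  have "char (distr M borel (\<lambda>\<omega>. X \<omega> * Y \<omega>)) t = (CLINT \<omega>|M. iexp (t * (X \<omega> * Y \<omega>)))"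
    by (simp add: char_def integral_distr)
  also have "\<dots> = (CLINT z|distr M ?B (\<lambda>\<omega>. (X \<omega>, Y \<omega>)). iexp (t * (fst z * snd z)))"
    by (subst integral_distr) simp_all
  also have "\<dots> = (CLINT z|?S. (\<lambda>z. iexp (t * (fst z * snd z)))
      (case z of (u, w) \<Rightarrow> (\<mu>\<^sub>X + (a * u + b * w), \<mu>\<^sub>Y + (c * u + d * w))))"
    unfolding law by (rule integral_distr) (simp_all add: measurable_std_normal_pair)
  also have "\<dots> = (CLINT z|?S. F (L z))"
    by (rule Bochner_Integration.integral_cong) (auto simp only: polar split_def fst_conv snd_conv prod.collapse)
  also have "\<dots> = integral\<^sup>L (distr ?S ?B L) F"
    by (rule integral_distr[OF L F, symmetric])
  also have "distr ?S ?B L = distr ?S ?B (\<lambda>(u, w). (e * u, f * w))"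
    unfolding L_def std_normal_pair_orthogonal_forms[OF orth] plus minus ..
  also have "integral\<^sup>L \<dots> F = (CLINT z|?S. F (case z of (u, w) \<Rightarrow> (e * u, f * w)))"
    by (rule integral_distr[OF _ F]) (simp add: measurable_std_normal_pair)
  also have "\<dots> = (CLINT (u, w)|?S. iexp (t * (s / 4) * (p + e * u)\<^sup>2) * iexp (- (t * (s / 4)) * (q + f * w)\<^sup>2))"
    by (rule Bochner_Integration.integral_cong) (simp_all add: F_def split_def)
  also have "\<dots> = (CLINT u|std_normal_distribution. iexp (t * (s / 4) * (p + e * u)\<^sup>2)) *
      (CLINT w|std_normal_distribution. iexp (- (t * (s / 4)) * (q + f * w)\<^sup>2))"
    by (intro has_bochner_integral_integral_eq std_normal_pair_integral_mult
        integrable_std_normal_iexp) measurable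
  finally show ?thesis
    unfolding p_def q_def e_def f_def .
qed

section \<open>Sums of independent copies\<close>

theorem theorem2p1:
  fixes M :: "'a measure" and X Y :: "'a \<Rightarrow> real"
    and P :: "'b measure" and Z :: "nat \<Rightarrow> 'b \<Rightarrow> real"
    and N :: "'c measure"
    and \<mu>\<^sub>X \<mu>\<^sub>Y \<sigma>\<^sub>X \<sigma>\<^sub>Y \<rho> s :: real and n :: nat
  assumes "prob_space M" and "prob_space P" and "prob_space N"
    and "\<sigma>\<^sub>X > 0" and "\<sigma>\<^sub>Y > 0" and "n \<ge> 1" and s: "s = \<sigma>\<^sub>X * \<sigma>\<^sub>Y"
    and "bivariate_normal M X Y"
    and "prob_space.expectation M X = \<mu>\<^sub>X" and "prob_space.expectation M Y = \<mu>\<^sub>Y"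
    and "prob_space.variance M X = \<sigma>\<^sub>X\<^sup>2" and "prob_space.variance M Y = \<sigma>\<^sub>Y\<^sup>2"
    and "correlation M X Y = \<rho>"
    and "prob_space.indep_vars P (\<lambda>_. borel) Z {1..n}"
    and "\<And>i. i \<in> {1..n} \<Longrightarrow> eq_in_distr P (Z i) M (\<lambda>\<omega>. X \<omega> * Y \<omega>)"
  shows
    "(\<rho> \<in> {-1<..<1} \<longrightarrow>
       (\<forall>V\<^sub>1 V\<^sub>2.
          noncentral_chi_square_rv N V\<^sub>1 n (n / (2 * (1 + \<rho>)) * (\<mu>\<^sub>X / \<sigma>\<^sub>X + \<mu>\<^sub>Y / \<sigma>\<^sub>Y)\<^sup>2) \<longrightarrow>
          noncentral_chi_square_rv N V\<^sub>2 n (n / (2 * (1 - \<rho>)) * (\<mu>\<^sub>X / \<sigma>\<^sub>X - \<mu>\<^sub>Y / \<sigma>\<^sub>Y)\<^sup>2) \<longrightarrow>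
          prob_space.indep_var N borel V\<^sub>1 borel V\<^sub>2 \<longrightarrow>
          eq_in_distr P (\<lambda>\<omega>. \<Sum>i=1..n. Z i \<omega>)
            N (\<lambda>\<omega>. s / 2 * (1 + \<rho>) * V\<^sub>1 \<omega> - s / 2 * (1 - \<rho>) * V\<^sub>2 \<omega>))) \<and>
     (\<rho> = 1 \<longrightarrow>
       (\<forall>V\<^sub>1.
          noncentral_chi_square_rv N V\<^sub>1 n (n * (\<mu>\<^sub>X / \<sigma>\<^sub>X + \<mu>\<^sub>Y / \<sigma>\<^sub>Y)\<^sup>2 / 4) \<longrightarrow>
          eq_in_distr P (\<lambda>\<omega>. \<Sum>i=1..n. Z i \<omega>)
            N (\<lambda>\<omega>. s * V\<^sub>1 \<omega> - n * s / 4 * (\<mu>\<^sub>X / \<sigma>\<^sub>X - \<mu>\<^sub>Y / \<sigma>\<^sub>Y)\<^sup>2))) \<and>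
     (\<rho> = -1 \<longrightarrow>
       (\<forall>V\<^sub>2.
          noncentral_chi_square_rv N V\<^sub>2 n (n * (\<mu>\<^sub>X / \<sigma>\<^sub>X - \<mu>\<^sub>Y / \<sigma>\<^sub>Y)\<^sup>2 / 4) \<longrightarrow>
          eq_in_distr P (\<lambda>\<omega>. \<Sum>i=1..n. Z i \<omega>)
            N (\<lambda>\<omega>. n * s / 4 * (\<mu>\<^sub>X / \<sigma>\<^sub>X + \<mu>\<^sub>Y / \<sigma>\<^sub>Y)\<^sup>2 - s * V\<^sub>2 \<omega>)))"
proof -
  interpret P: prob_space P by fact
  interpret N: prob_space N by fact
  let ?p = "\<mu>\<^sub>X / \<sigma>\<^sub>X + \<mu>\<^sub>Y / \<sigma>\<^sub>Y" and ?q = "\<mu>\<^sub>X / \<sigma>\<^sub>X - \<mu>\<^sub>Y / \<sigma>\<^sub>Y"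
  let ?S = "\<lambda>\<omega>. \<Sum>i=1..n. Z i \<omega>"
  define G where "G t m \<alpha> = (CLINT u|std_normal_distribution. iexp (t * (m + \<alpha> * u)\<^sup>2))" for t m \<alpha>
  have Z: "Z i \<in> borel_measurable P" "distr P borel (Z i) = distr M borel (\<lambda>\<omega>. X \<omega> * Y \<omega>)"
    if "i \<in> {1..n}" for i
    using assms(15)[OF that] by (simp_all add: eq_in_distr_def)
  have S: "?S \<in> borel_measurable P"
    using Z(1) by (rule borel_measurable_sum)
  have char_S: "char (distr P borel ?S) t =
      (G (t * (s / 4)) ?p (sqrt (2 * (1 + \<rho>))) * G (- (t * (s / 4))) ?q (sqrt (2 * (1 - \<rho>)))) ^ n" for t
  proof -
    have "char (distr P borel ?S) t = (\<Prod>i=1..n. char (distr P borel (Z i)) t)"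
      by (rule P.char_distr_sum) fact
    also have "\<dots> = char (distr M borel (\<lambda>\<omega>. X \<omega> * Y \<omega>)) t ^ n"
      by (simp add: Z(2))
    also have "char (distr M borel (\<lambda>\<omega>. X \<omega> * Y \<omega>)) t =
        G (t * (s / 4)) ?p (sqrt (2 * (1 + \<rho>))) * G (- (t * (s / 4))) ?q (sqrt (2 * (1 - \<rho>)))"
      unfolding G_def s char_bivariate_normal_product[OF assms(8,4,5,11,12,13)] assms(9,10) ..
    finally show ?thesis .
  qed
  have eqI: "eq_in_distr P ?S N W"
    if W: "W \<in> borel_measurable N"
      and "\<And>t. char (distr P borel ?S) t = char (distr N borel W) t" for W
    unfolding eq_in_distr_def using S W that(2)
    by (intro conjI Levy_uniqueness P.real_distribution_distr N.real_distribution_distr ext)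
  have G: "G t m \<alpha> = shifted_square_char (m / \<alpha>) (t * \<alpha>\<^sup>2)" if "\<alpha> \<noteq> 0" for t m \<alpha>
    unfolding G_def by (rule integral_iexp_scaled_square[OF that])
  have G0: "G t m 0 = iexp (t * m\<^sup>2)" for t m
    using prob_space.prob_space[OF prob_space_std_normal] by (simp add: G_def)
  have chi: "V \<in> borel_measurable N" "char (distr N borel V) t = shifted_square_char m t ^ n"
    if "noncentral_chi_square_rv N V n l" "l = real n * m\<^sup>2" for V l m t
    using that char_noncentral_chi_square by (auto simp: noncentral_chi_square_rv_def)
  show ?thesis
  proof (intro conjI impI allI)
    fix V\<^sub>1 V\<^sub>2
    assume \<rho>: "\<rho> \<in> {-1<..<1}"
      and V1: "noncentral_chi_square_rv N V\<^sub>1 n (n / (2 * (1 + \<rho>)) * ?p\<^sup>2)"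
      and V2: "noncentral_chi_square_rv N V\<^sub>2 n (n / (2 * (1 - \<rho>)) * ?q\<^sup>2)"
      and indep: "prob_space.indep_var N borel V\<^sub>1 borel V\<^sub>2"
    let ?e = "sqrt (2 * (1 + \<rho>))" and ?f = "sqrt (2 * (1 - \<rho>))"
    have pos: "?e \<noteq> 0" "?f \<noteq> 0" and sq: "?e\<^sup>2 = 2 * (1 + \<rho>)" "?f\<^sup>2 = 2 * (1 - \<rho>)"
      using \<rho> by simp_all
    have l: "n / (2 * (1 + \<rho>)) * ?p\<^sup>2 = n * (?p / ?e)\<^sup>2" "n / (2 * (1 - \<rho>)) * ?q\<^sup>2 = n * (?q / ?f)\<^sup>2"
      unfolding power_divide sq by simp_all
    note c1 = chi[OF V1 l(1)] and c2 = chi[OF V2 l(2)]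
    \<comment> \<open>The summands \<open>+ 0\<close> give both terms the shape of \<open>char_affine\<close>.\<close>
    let ?W1 = "\<lambda>\<omega>. s / 2 * (1 + \<rho>) * V\<^sub>1 \<omega> + 0" and ?W2 = "\<lambda>\<omega>. - (s / 2 * (1 - \<rho>)) * V\<^sub>2 \<omega> + 0"
    have ind: "N.indep_var borel ?W1 borel ?W2"
      using N.indep_var_compose[OF indep, of "\<lambda>v. s / 2 * (1 + \<rho>) * v + 0" borel
          "\<lambda>v. - (s / 2 * (1 - \<rho>)) * v + 0" borel]
      by (simp add: comp_def)
    have "eq_in_distr P ?S N (\<lambda>\<omega>. ?W1 \<omega> + ?W2 \<omega>)"
    proof (rule eqI)
      show "(\<lambda>\<omega>. ?W1 \<omega> + ?W2 \<omega>) \<in> borel_measurable N"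
        using c1(1) c2(1) by measurable
      fix t
      have char_W: "char (distr N borel (\<lambda>\<omega>. ?W1 \<omega> + ?W2 \<omega>)) t =
          shifted_square_char (?p / ?e) (t * (s / 2 * (1 + \<rho>))) ^ n *
          shifted_square_char (?q / ?f) (t * - (s / 2 * (1 - \<rho>))) ^ n"
        unfolding N.char_distr_add[OF ind] char_affine[OF c1(1)] char_affine[OF c2(1)] c1(2) c2(2)
        by simp
      have args: "t * (s / 4) * ?e\<^sup>2 = t * (s / 2 * (1 + \<rho>))"
          "- (t * (s / 4)) * ?f\<^sup>2 = t * - (s / 2 * (1 - \<rho>))"
        unfolding sq by (simp_all add: field_simps)
      show "char (distr P borel ?S) t = char (distr N borel (\<lambda>\<omega>. ?W1 \<omega> + ?W2 \<omega>)) t"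
        unfolding char_W char_S G[OF pos(1)] G[OF pos(2)] args power_mult_distrib ..
    qed
    then show "eq_in_distr P ?S N (\<lambda>\<omega>. s / 2 * (1 + \<rho>) * V\<^sub>1 \<omega> - s / 2 * (1 - \<rho>) * V\<^sub>2 \<omega>)"
      by simp
  next
    fix V\<^sub>1
    assume \<rho>: "\<rho> = 1" and V1: "noncentral_chi_square_rv N V\<^sub>1 n (n * ?p\<^sup>2 / 4)"
    have l: "n * ?p\<^sup>2 / 4 = n * (?p / 2)\<^sup>2"
      by (simp add: power_divide)
    note c = chi[OF V1 l]
    have "eq_in_distr P ?S N (\<lambda>\<omega>. s * V\<^sub>1 \<omega> + - (n * s / 4 * ?q\<^sup>2))"
    proof (rule eqI)
      show "(\<lambda>\<omega>. s * V\<^sub>1 \<omega> + - (n * s / 4 * ?q\<^sup>2)) \<in> borel_measurable N"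
        using c(1) by measurable
      fix t
      have "iexp (- (t * (s / 4)) * ?q\<^sup>2) ^ n = iexp (t * - (n * s / 4 * ?q\<^sup>2))"
        by (simp add: mult_ac flip: exp_of_nat_mult)
      then show "char (distr P borel ?S) t = char (distr N borel (\<lambda>\<omega>. s * V\<^sub>1 \<omega> + - (n * s / 4 * ?q\<^sup>2))) t"
        unfolding char_affine[OF c(1)] c(2) char_S \<rho> by (simp add: G G0 power_mult_distrib)
    qed
    then show "eq_in_distr P ?S N (\<lambda>\<omega>. s * V\<^sub>1 \<omega> - n * s / 4 * ?q\<^sup>2)"
      by simp
  next
    fix V\<^sub>2
    assume \<rho>: "\<rho> = -1" and V2: "noncentral_chi_square_rv N V\<^sub>2 n (n * ?q\<^sup>2 / 4)"
    have l: "n * ?q\<^sup>2 / 4 = n * (?q / 2)\<^sup>2"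
      by (simp add: power_divide)
    note c = chi[OF V2 l]
    have "eq_in_distr P ?S N (\<lambda>\<omega>. - s * V\<^sub>2 \<omega> + n * s / 4 * ?p\<^sup>2)"
    proof (rule eqI)
      show "(\<lambda>\<omega>. - s * V\<^sub>2 \<omega> + n * s / 4 * ?p\<^sup>2) \<in> borel_measurable N"
        using c(1) by measurable
      fix t
      have "iexp (t * (s / 4) * ?p\<^sup>2) ^ n = iexp (t * (n * s / 4 * ?p\<^sup>2))"
        by (simp add: mult_ac flip: exp_of_nat_mult)
      then show "char (distr P borel ?S) t = char (distr N borel (\<lambda>\<omega>. - s * V\<^sub>2 \<omega> + n * s / 4 * ?p\<^sup>2)) t"
        unfolding char_affine[OF c(1)] c(2) char_S \<rho> by (simp add: G G0 power_mult_distrib)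
    qed
    then show "eq_in_distr P ?S N (\<lambda>\<omega>. n * s / 4 * ?p\<^sup>2 - s * V\<^sub>2 \<omega>)"
      by simp
  qed
qed

end
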